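(* Let $L$ be a finite-dimensional solvable Lie algebra over an arbitrary field $F$. Then $\gamma(L) = \tau(L)$.
   Context: For $x \in L$, the Engel subalgebra $E_L(x)$ is the Fitting null-component of $L$ relative to $\mathrm{ad}\,x$, i.e. $E_L(x) = \{y \in L : (\mathrm{ad}\,x)^n(y) = 0 \text{ for some } n\}$. For a subalgebra $U$ of $L$, the core $U_L$ is the largest ideal of $L$ contained in $U$, and the idealiser is $I_L(U) = \{x \in L : [x,U] \subseteq U\}$. Let $\mathcal{G}_L$ be the set of all maximal subalgebras $M$ of $L$ such that $E_L(x) \subseteq M$ for some $x \in L$. Put $G(L) = \bigcap_{M \in \mathcal{G}_L} M$ if $\mathcal{G}_L \neq \emptyset$ and $G(L) = L$ otherwise, and $\gamma(L) = G(L)_L$. Let $\mathcal{T}_L$ be the set of all maximal subalgebras $M$ of $L$ with $I_L(M) = M$. Put $T(L) = \bigcap_{M \in \mathcal{T}_L} M$ if $\mathcal{T}_L \neq \emptyset$ and $T(L) = L$ otherwise, and $\tau(L) = T(L)_L$. *)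

theory Defs
  imports Complex_Main
begin

locale lie_algebra = vector_space scale
  for scale :: "'f::field \<Rightarrow> 'a::ab_group_add \<Rightarrow> 'a" +
  fixes bracket :: "'a \<Rightarrow> 'a \<Rightarrow> 'a"
  assumes linear_bracket_right: "Vector_Spaces.linear scale scale (\<lambda>y. bracket x y)"
    and linear_bracket_left: "Vector_Spaces.linear scale scale (\<lambda>x. bracket x y)"
    and bracket_self: "bracket x x = 0"
    and jacobi: "bracket x (bracket y z) + bracket y (bracket z x) + bracket z (bracket x y) = 0"
begin

text \<open>The Lie algebra \<open>L\<close> is the whole type, so \<open>UNIV\<close> below plays the role of \<open>L\<close>.\<close>

definition subalgebra :: "'a set \<Rightarrow> bool" where
  "subalgebra U \<longleftrightarrow> subspace U \<and> (\<forall>x\<in>U. \<forall>y\<in>U. bracket x y \<in> U)"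

definition lie_ideal :: "'a set \<Rightarrow> bool" where
  "lie_ideal I \<longleftrightarrow> subspace I \<and> (\<forall>x. \<forall>y\<in>I. bracket x y \<in> I)"

definition maximal_subalgebra :: "'a set \<Rightarrow> bool" where
  "maximal_subalgebra M \<longleftrightarrow> subalgebra M \<and> M \<noteq> UNIV \<and>
     (\<forall>U. subalgebra U \<and> M \<subseteq> U \<longrightarrow> U = M \<or> U = UNIV)"

definition derived :: "'a set \<Rightarrow> 'a set" where
  "derived U = span {bracket x y |x y. x \<in> U \<and> y \<in> U}"

definition solvable :: bool where
  "solvable \<longleftrightarrow> (\<exists>n. (derived ^^ n) UNIV = {0})"

definition engel :: "'a \<Rightarrow> 'a set" where
  "engel x = {y. \<exists>n. (bracket x ^^ n) y = 0}"

definition idealiser :: "'a set \<Rightarrow> 'a set" where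
  "idealiser U = {x. \<forall>u\<in>U. bracket x u \<in> U}"

text \<open>\<open>GREATEST\<close> is with respect to inclusion; lemma \<open>core_greatest\<close> below shows that the
  largest ideal exists for every subspace \<open>U\<close>.\<close>

definition core :: "'a set \<Rightarrow> 'a set" where
  "core U = (GREATEST I. lie_ideal I \<and> I \<subseteq> U)"

definition G_max :: "'a set set" where
  "G_max = {M. maximal_subalgebra M \<and> (\<exists>x. engel x \<subseteq> M)}"

definition G_int :: "'a set" where
  "G_int = (if G_max \<noteq> {} then \<Inter>G_max else UNIV)"

definition gamma :: "'a set" where
  "gamma = core G_int"

definition T_max :: "'a set set" where
  "T_max = {M. maximal_subalgebra M \<and> idealiser M = M}"

definition T_int :: "'a set" where
  "T_int = (if T_max \<noteq> {} then \<Inter>T_max else UNIV)"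

definition tau :: "'a set" where
  "tau = core T_int"

lemma core_greatest:
  assumes U: "subspace U"
  shows "lie_ideal (core U)" "core U \<subseteq> U" "\<And>J. lie_ideal J \<Longrightarrow> J \<subseteq> U \<Longrightarrow> J \<subseteq> core U"
proof -
  define S where "S = \<Union>{J. lie_ideal J \<and> J \<subseteq> U}"
  have br: "bracket x y \<in> span S" if "y \<in> span S" for x y
  proof -
    interpret l: Vector_Spaces.linear scale scale "\<lambda>y. bracket x y"
      by (rule linear_bracket_right)
    have "(\<lambda>y. bracket x y) ` S \<subseteq> S"
      unfolding S_def lie_ideal_def by blast
    then have "span ((\<lambda>y. bracket x y) ` S) \<subseteq> span S"
      by (rule span_mono)
    with that show ?thesis
      unfolding l.span_image by blast
  qed
  have id: "lie_ideal (span S)"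
    unfolding lie_ideal_def using br by simp
  have sub: "span S \<subseteq> U"
    by (rule span_minimal) (auto simp: S_def U)
  have ub: "J \<subseteq> span S" if "lie_ideal J" "J \<subseteq> U" for J
    using that span_superset[of S] unfolding S_def by blast
  have "core U = span S"
    unfolding core_def by (rule Greatest_equality) (use id sub ub in auto)
  with id sub ub
  show "lie_ideal (core U)" "core U \<subseteq> U" "\<And>J. lie_ideal J \<Longrightarrow> J \<subseteq> U \<Longrightarrow> J \<subseteq> core U"
    by simp_all
qed

lemma subspace_G_int: "subspace G_int" and subspace_T_int: "subspace T_int"
  unfolding G_int_def T_int_def G_max_def T_max_def maximal_subalgebra_def subalgebra_def
  by (auto intro!: subspace_Inter)

end

end

theory Submission
  imports Defs
begin

text \<open>
  In a solvable algebra the two families of maximal subalgebras coincide: a maximal subalgebra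
  contains an Engel subalgebra if and only if it is its own idealiser. Equality of the
  intersections and of their cores is then immediate.

  One direction holds for all subalgebras \<open>M\<close> (\<open>idealiser_of_engel_superset\<close>):
  if \<open>engel x \<subseteq> M\<close>, then \<open>ad x\<close> acts injectively on \<open>L / M\<close>, and an element of the
  idealiser of \<open>M\<close> is sent to zero there, as \<open>x\<close> itself lies in \<open>M\<close>.

  For the other direction (\<open>engel_subset_of_idealiser_eq\<close>) let \<open>A\<close> be minimal among the
  ideals not contained in the maximal subalgebra \<open>M\<close>, and \<open>C = A \<inter> M\<close>. Solvability
  and minimality give \<open>[A, A] \<subseteq> C\<close>, so that \<open>L = A + M\<close> and \<open>A / C\<close> is an irreducible
  \<open>M\<close>-module. It is not a trivial one, as otherwise \<open>A\<close> would idealise \<open>M\<close>.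
  Hence the last term \<open>D\<close> of the derived series of \<open>L\<close>, intersected with \<open>M\<close>, that acts
  nontrivially on \<open>A / C\<close> is an ideal of \<open>M\<close> acting through commuting operators. Such a \<open>D\<close> contains
  an \<open>x\<close> acting injectively on \<open>A / C\<close> (\<open>exists_acting_injectively\<close>). An element \<open>a + m\<close>
  killed by a power of \<open>ad x\<close> has \<open>a \<in> C\<close>, because \<open>ad x\<close> respects the direct
  decomposition of \<open>L / C\<close> into \<open>A / C\<close> and \<open>M / C\<close>. Therefore \<open>engel x \<subseteq> M\<close>.
\<close>

section \<open>Adjoint maps, ideals and the derived series\<close>

context lie_algebra
begin

sublocale endo: vector_space_pair scale scale ..

lemma bracket_add_right: "bracket x (y + z) = bracket x y + bracket x z"
  by (rule endo.linear_add[OF linear_bracket_right])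

lemma bracket_add_left: "bracket (x + y) z = bracket x z + bracket y z"
  by (rule endo.linear_add[OF linear_bracket_left])

lemma bracket_zero_right [simp]: "bracket x 0 = 0"
  by (rule endo.linear_0[OF linear_bracket_right])

lemma bracket_swap: "bracket x y = - bracket y x"
proof -
  have "bracket (x + y) (x + y) = bracket x y + bracket y x"
    unfolding bracket_add_left bracket_add_right by (simp add: bracket_self)
  then show ?thesis
    by (simp add: bracket_self eq_neg_iff_add_eq_0)
qed

lemma bracket_minus_right: "bracket x (- y) = - bracket x y"
  by (rule endo.linear_neg[OF linear_bracket_right])

lemma bracket_leibniz: "bracket x (bracket y z) = bracket (bracket x y) z + bracket y (bracket x z)"
proof -
  have "bracket y (bracket z x) = - bracket y (bracket x z)"
    by (metis bracket_minus_right bracket_swap)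
  moreover have "bracket z (bracket x y) = - bracket (bracket x y) z"
    by (rule bracket_swap)
  ultimately show ?thesis
    using jacobi[of x y z] by (simp add: algebra_simps add_eq_0_iff)
qed

lemma bracket_mem_swap:
  assumes "subspace U" "bracket x y \<in> U"
  shows "bracket y x \<in> U"
  using subspace_neg[OF assms] bracket_swap[of y x] by simp

lemma linear_bracket_power: "Vector_Spaces.linear scale scale (bracket x ^^ n)"
proof (induction n)
  case 0
  show ?case using linear_id by (simp add: id_def)
next
  case (Suc n)
  show ?case
    using Vector_Spaces.linear_compose[OF Suc linear_bracket_right[of x]] by (simp add: comp_def)
qed

lemma subspace_bracket_power_preimage:
  assumes "subspace U"
  shows "subspace {y. (bracket x ^^ n) y \<in> U}"
  using endo.linear_subspace_vimage[OF linear_bracket_power assms] by (simp add: vimage_def)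

lemma subspace_bracket_preimage:
  assumes "subspace U"
  shows "subspace {y. bracket x y \<in> U}"
  using subspace_bracket_power_preimage[OF assms, where n = 1 and x = x] by simp

lemma bracket_power_mem:
  assumes "\<And>u. u \<in> U \<Longrightarrow> bracket x u \<in> U" "u \<in> U"
  shows "(bracket x ^^ n) u \<in> U"
  by (induction n) (use assms in auto)

lemma bracket_power_mem_mono:
  assumes "\<And>u. u \<in> U \<Longrightarrow> bracket x u \<in> U" "(bracket x ^^ n) y \<in> U" "n \<le> m"
  shows "(bracket x ^^ m) y \<in> U"
proof -
  have "(bracket x ^^ (m - n)) ((bracket x ^^ n) y) \<in> U"
    by (rule bracket_power_mem) (use assms in auto)
  then show ?thesis
    using assms(3) by (metis comp_apply funpow_add le_add_diff_inverse2)
qed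

lemma bracket_mem_derived: "x \<in> U \<Longrightarrow> y \<in> U \<Longrightarrow> bracket x y \<in> derived U"
  unfolding derived_def by (intro span_base) blast

lemma derived_mono: "U \<subseteq> V \<Longrightarrow> derived U \<subseteq> derived V"
  unfolding derived_def by (intro span_mono) blast

lemma derived_subset:
  assumes "subspace V" "\<And>x y. x \<in> U \<Longrightarrow> y \<in> U \<Longrightarrow> bracket x y \<in> V"
  shows "derived U \<subseteq> V"
  unfolding derived_def using assms by (intro span_minimal) auto

lemma lie_ideal_derived:
  assumes "lie_ideal I"
  shows "lie_ideal (derived I)"
proof -
  have sub: "subspace (derived I)"
    unfolding derived_def by (rule subspace_span)
  have I: "\<And>x y. y \<in> I \<Longrightarrow> bracket x y \<in> I"
    using assms unfolding lie_ideal_def by blast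
  have "derived I \<subseteq> {y. bracket x y \<in> derived I}" for x
  proof (rule derived_subset[OF subspace_bracket_preimage[OF sub]])
    fix y z assume "y \<in> I" "z \<in> I"
    then show "bracket y z \<in> {y. bracket x y \<in> derived I}"
      using bracket_leibniz[of x y z] I
      by (auto intro!: subspace_add[OF sub] bracket_mem_derived)
  qed
  then show ?thesis
    unfolding lie_ideal_def using sub by blast
qed

lemma lie_ideal_derived_series: "lie_ideal ((derived ^^ n) UNIV)"
  by (induction n) (auto simp: lie_ideal_derived, simp add: lie_ideal_def)

lemma perfect_subset_zero:
  assumes "solvable" "derived I = I"
  shows "I \<subseteq> {0}"
proof -
  have "I \<subseteq> (derived ^^ n) UNIV" for n
  proof (induction n)
    case (Suc n)
    then show ?case using derived_mono[OF Suc] assms(2) by simp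
  qed simp
  then show ?thesis
    using assms(1) unfolding solvable_def by blast
qed

text \<open>The derived series ends at zero, so some term of it is the last one whose intersection with
  \<open>M\<close> is not contained in \<open>K\<close>. When \<open>M\<close> is a subalgebra, brackets of elements of this
  intersection lie in \<open>K\<close>: this is how solvability supplies abelian sections.\<close>

lemma solvable_last_derived:
  assumes "solvable" "\<not> M \<subseteq> K" "0 \<in> K"
  obtains i where "\<not> M \<inter> (derived ^^ i) UNIV \<subseteq> K" "M \<inter> (derived ^^ Suc i) UNIV \<subseteq> K"
proof -
  obtain n where n: "(derived ^^ n) UNIV = {0}"
    using assms(1) unfolding solvable_def by blast
  define P where "P i \<longleftrightarrow> M \<inter> (derived ^^ i) UNIV \<subseteq> K" for i
  have "P n" "\<not> P 0"
    using n assms by (auto simp: P_def)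
  then have "\<exists>i. \<not> P i \<and> P (Suc i)"
    using nat_induct[of "\<lambda>i. \<not> P i" n] by blast
  then show thesis
    using that unfolding P_def by blast
qed

section \<open>Fitting components on an irreducible section\<close>

text \<open>Below, \<open>A / C\<close> is regarded as an \<open>M\<close>-module without forming the quotient:
  statements about \<open>A / C\<close> are statements about \<open>A\<close> modulo \<open>C\<close>.

  When \<open>[x, m]\<close> commutes with \<open>x\<close> as operators on \<open>A / C\<close>, the operator
  \<open>m\<close> moves the kernel of the \<open>k\<close>-th power of \<open>x\<close> at most into
  the kernel of the next power; hence \<open>m\<close> preserves the Fitting null component of \<open>x\<close>.\<close>

lemma fitting_null_step:
  assumes C: "subspace C" and A: "\<And>a. a \<in> A \<Longrightarrow> bracket x a \<in> A"
    and inv: "\<And>c. c \<in> C \<Longrightarrow> bracket x c \<in> C" "\<And>c. c \<in> C \<Longrightarrow> bracket m c \<in> C"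
      "\<And>c. c \<in> C \<Longrightarrow> bracket (bracket x m) c \<in> C"
    and comm: "\<And>a. a \<in> A \<Longrightarrow> bracket (bracket x (bracket x m)) a \<in> C"
    and a: "a \<in> A" "(bracket x ^^ k) a \<in> C"
  shows "(bracket x ^^ Suc k) (bracket m a) \<in> C"
proof -
  let ?d = "bracket x m"
  have pC: "(bracket x ^^ j) c \<in> C" if "c \<in> C" for c j
    using bracket_power_mem[of C x c j] inv(1) that by blast
  \<comment> \<open>Modulo \<open>C\<close>, \<open>?d\<close> commutes with \<open>x\<close> and so preserves each kernel.\<close>
  have d: "(bracket x ^^ j) (bracket ?d b) \<in> C" if "b \<in> A" "(bracket x ^^ j) b \<in> C" for j b
    using that
  proof (induction j arbitrary: b)
    case 0
    then show ?case using inv(3) by simp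
  next
    case (Suc j)
    have "(bracket x ^^ Suc j) (bracket ?d b) =
        (bracket x ^^ j) (bracket (bracket x ?d) b) + (bracket x ^^ j) (bracket ?d (bracket x b))"
      unfolding funpow_Suc_right comp_apply bracket_leibniz[of x ?d b]
      by (rule endo.linear_add[OF linear_bracket_power])
    moreover have "(bracket x ^^ j) (bracket ?d (bracket x b)) \<in> C"
      using Suc.IH[of "bracket x b"] Suc.prems A unfolding funpow_Suc_right comp_apply by blast
    moreover have "(bracket x ^^ j) (bracket (bracket x ?d) b) \<in> C"
      using pC comm Suc.prems(1) by blast
    ultimately show ?case
      using subspace_add[OF C] by metis
  qed
  show ?thesis
    using a
  proof (induction k arbitrary: a)
    case 0
    then show ?case using inv by simp
  next
    case (Suc k)
    have "(bracket x ^^ Suc (Suc k)) (bracket m a) =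
        (bracket x ^^ Suc k) (bracket ?d a) + (bracket x ^^ Suc k) (bracket m (bracket x a))"
      unfolding funpow_Suc_right[of "Suc k"] comp_apply bracket_leibniz[of x m a]
      by (rule endo.linear_add[OF linear_bracket_power])
    moreover have "(bracket x ^^ Suc k) (bracket m (bracket x a)) \<in> C"
      using Suc.IH[of "bracket x a"] Suc.prems A unfolding funpow_Suc_right comp_apply by blast
    moreover have "(bracket x ^^ Suc k) (bracket ?d a) \<in> C"
      using d Suc.prems by blast
    ultimately show ?case
      using subspace_add[OF C] by metis
  qed
qed

end

locale finite_dimensional_lie_algebra =
  lie_algebra scale bracket + finite_dimensional_vector_space scale Basis
  for scale :: "'f::field \<Rightarrow> 'a::ab_group_add \<Rightarrow> 'a"
    and bracket :: "'a \<Rightarrow> 'a \<Rightarrow> 'a"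
    and Basis :: "'a set"
begin

lemma minimal_subspace_exists:
  assumes "P W0" "\<And>W. P W \<Longrightarrow> subspace W"
  obtains W where "P W" "\<And>V. P V \<Longrightarrow> V \<subseteq> W \<Longrightarrow> V = W"
proof -
  obtain W where "P W" "\<And>V. P V \<Longrightarrow> dim W \<le> dim V"
    using ex_has_least_nat[of P W0 dim] assms(1) by blast
  then show thesis
    using that assms(2) subspace_dim_equal by metis
qed

text \<open>The case of Engel's theorem that is needed: pairwise commuting nilpotent operators have a
  common kernel vector. In a minimal nonzero invariant subspace the kernel of each operator is
  invariant, because the operators commute, and nonzero, because the operator is nilpotent; so it
  is the whole of that subspace.\<close>

lemma commuting_nilpotent_common_kernel:
  assumes A: "subspace A" and C: "subspace C" and CA: "C \<subset> A"
    and inv: "\<And>x a. x \<in> D \<Longrightarrow> a \<in> A \<Longrightarrow> bracket x a \<in> A"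
      "\<And>x c. x \<in> D \<Longrightarrow> c \<in> C \<Longrightarrow> bracket x c \<in> C"
    and comm: "\<And>x y a. x \<in> D \<Longrightarrow> y \<in> D \<Longrightarrow> a \<in> A \<Longrightarrow> bracket (bracket x y) a \<in> C"
    and nil: "\<And>x a. x \<in> D \<Longrightarrow> a \<in> A \<Longrightarrow> \<exists>n. (bracket x ^^ n) a \<in> C"
  shows "\<exists>a\<in>A - C. \<forall>x\<in>D. bracket x a \<in> C"
proof -
  define P where "P W \<longleftrightarrow> subspace W \<and> C \<subset> W \<and> W \<subseteq> A \<and> (\<forall>x\<in>D. \<forall>w\<in>W. bracket x w \<in> W)" for W
  have "P A"
    unfolding P_def using A CA inv by blast
  then obtain W where W: "P W" and min: "\<And>V. P V \<Longrightarrow> V \<subseteq> W \<Longrightarrow> V = W"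
    by (rule minimal_subspace_exists) (auto simp: P_def)
  have Wsub: "subspace W" "C \<subset> W" "W \<subseteq> A" and Winv: "\<And>x w. x \<in> D \<Longrightarrow> w \<in> W \<Longrightarrow> bracket x w \<in> W"
    using W unfolding P_def by blast+
  have kill: "bracket x w \<in> C" if x: "x \<in> D" and w: "w \<in> W" for x w
  proof -
    define V where "V = W \<inter> {v. bracket x v \<in> C}"
    have "subspace V"
      unfolding V_def by (intro subspace_inter Wsub subspace_bracket_preimage C)
    moreover have "C \<subset> V"
    proof -
      obtain u where u: "u \<in> W" "u \<notin> C"
        using Wsub by blast
      \<comment> \<open>The last iterate of \<open>u\<close> outside \<open>C\<close> lies in the kernel modulo \<open>C\<close>.\<close>
      define n where "n = (LEAST n. (bracket x ^^ n) u \<in> C)"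
      have "u \<in> A"
        using u Wsub by blast
      then have n: "(bracket x ^^ n) u \<in> C"
        unfolding n_def by (rule LeastI_ex[OF nil[OF x]])
      with u have "n \<noteq> 0"
        by (intro notI) simp
      then obtain j where j: "n = Suc j"
        using not0_implies_Suc by blast
      have "(bracket x ^^ j) u \<notin> C"
        by (rule not_less_Least) (use j n_def in simp)
      moreover have "(bracket x ^^ j) u \<in> W"
        using bracket_power_mem[of W x u j] Winv[OF x] u by blast
      moreover have "C \<subseteq> V"
        unfolding V_def using Wsub inv(2)[OF x] by blast
      ultimately show ?thesis
        using n unfolding V_def j by auto
    qed
    moreover have "bracket y v \<in> V" if y: "y \<in> D" and v: "v \<in> V" for y v
    proof -
      have "bracket x (bracket y v) = bracket (bracket x y) v + bracket y (bracket x v)"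
        by (rule bracket_leibniz)
      moreover have "bracket (bracket x y) v \<in> C" "bracket y (bracket x v) \<in> C"
        using v Wsub comm[OF x y] inv(2)[OF y] unfolding V_def by blast+
      ultimately show ?thesis
        using v Winv[OF y] subspace_add[OF C] unfolding V_def by simp
    qed
    ultimately have "P V"
      unfolding P_def V_def using Wsub by blast
    then have "V = W"
      by (rule min) (simp add: V_def)
    then show ?thesis
      using w unfolding V_def by blast
  qed
  then show ?thesis
    using Wsub by blast
qed

text \<open>The null component of each \<open>x \<in> D\<close> on \<open>A / C\<close> is \<open>M\<close>-invariant, so by irreducibility it
  is zero or everything. If it were everything for all \<open>x \<in> D\<close>, then the vectors killed by \<open>D\<close>
  would form a nonzero \<open>M\<close>-submodule, hence all of \<open>A / C\<close>, contrary to \<open>D\<close> acting nontrivially.\<close>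

lemma exists_acting_injectively:
  assumes A: "subspace A" and C: "subspace C" and CA: "C \<subseteq> A"
    and MA: "\<And>m a. m \<in> M \<Longrightarrow> a \<in> A \<Longrightarrow> bracket m a \<in> A"
    and MC: "\<And>m c. m \<in> M \<Longrightarrow> c \<in> C \<Longrightarrow> bracket m c \<in> C"
    and irr: "\<And>W. subspace W \<Longrightarrow> C \<subseteq> W \<Longrightarrow> W \<subseteq> A \<Longrightarrow> (\<And>m w. m \<in> M \<Longrightarrow> w \<in> W \<Longrightarrow> bracket m w \<in> W)
      \<Longrightarrow> W = C \<or> W = A"
    and DM: "D \<subseteq> M" and MD: "\<And>m d. m \<in> M \<Longrightarrow> d \<in> D \<Longrightarrow> bracket d m \<in> D"
    and comm: "\<And>x y a. x \<in> D \<Longrightarrow> y \<in> D \<Longrightarrow> a \<in> A \<Longrightarrow> bracket (bracket x y) a \<in> C"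
    and nontriv: "e \<in> D" "b \<in> A" "bracket e b \<notin> C"
  shows "\<exists>x\<in>D. \<forall>a\<in>A. \<forall>n. (bracket x ^^ n) a \<in> C \<longrightarrow> a \<in> C"
proof (rule ccontr)
  assume no: "\<not> ?thesis"
  \<comment> \<open>Irreducibility applied to the Fitting null component \<open>N\<close> of \<open>x\<close>.\<close>
  have nil: "\<exists>n. (bracket x ^^ n) a \<in> C" if x: "x \<in> D" and a: "a \<in> A" for x a
  proof -
    have xM: "x \<in> M"
      using x DM by blast
    define N where "N = {a\<in>A. \<exists>n. (bracket x ^^ n) a \<in> C}"
    have mono: "(bracket x ^^ k) b \<in> C" if "(bracket x ^^ j) b \<in> C" "j \<le> k" for b j k
      using bracket_power_mem_mono[of C x j b k] MC[OF xM] that by blast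
    have "subspace N"
      unfolding subspace_def
    proof (intro conjI ballI allI)
      show "0 \<in> N"
        unfolding N_def using subspace_0[OF A] subspace_0[OF C] by (auto intro!: exI[of _ 0])
    next
      fix u v assume "u \<in> N" "v \<in> N"
      then obtain j k where "u \<in> A" "v \<in> A" "(bracket x ^^ j) u \<in> C" "(bracket x ^^ k) v \<in> C"
        unfolding N_def by blast
      moreover from this have "(bracket x ^^ max j k) u \<in> C" "(bracket x ^^ max j k) v \<in> C"
        by (auto intro: mono)
      ultimately show "u + v \<in> N"
        unfolding N_def
        using subspace_add[OF A] subspace_add[OF subspace_bracket_power_preimage[OF C]] by blast
    next
      fix c u assume "u \<in> N"
      then show "scale c u \<in> N"
        unfolding N_def
        using subspace_scale[OF A] subspace_scale[OF subspace_bracket_power_preimage[OF C]] by blast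
    qed
    moreover have "C \<subseteq> N"
      unfolding N_def using CA by (auto intro!: exI[of _ 0])
    moreover have "N \<subseteq> A"
      unfolding N_def by blast
    moreover have "bracket m u \<in> N" if m: "m \<in> M" and u: "u \<in> N" for m u
    proof -
      obtain k where k: "u \<in> A" "(bracket x ^^ k) u \<in> C"
        using u unfolding N_def by blast
      have xm: "bracket x m \<in> D"
        using MD m x by blast
      have "(bracket x ^^ Suc k) (bracket m u) \<in> C"
        by (rule fitting_null_step[where A = A])
          (use C MA[OF xM] MC[OF xM] MC[OF m] MC xm DM comm[OF x xm] k in blast)+
      then show ?thesis
        unfolding N_def using MA m k(1) by blast
    qed
    ultimately have "N = C \<or> N = A"
      by (rule irr)
    moreover have "N \<noteq> C"
      using no x unfolding N_def by blast
    ultimately show ?thesis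
      using a unfolding N_def by blast
  qed
  have "C \<subset> A"
    using CA nontriv MC DM by blast
  then have ker: "\<exists>a\<in>A - C. \<forall>x\<in>D. bracket x a \<in> C"
    using commuting_nilpotent_common_kernel[OF A C, of D] MA MC DM comm nil by blast
  define Z where "Z = A \<inter> (\<Inter>d\<in>D. {a. bracket d a \<in> C})"
  have "subspace Z"
    unfolding Z_def by (intro subspace_inter subspace_Int A subspace_bracket_preimage C)
  moreover have "C \<subseteq> Z" "Z \<subseteq> A"
    unfolding Z_def using CA MC DM by blast+
  moreover have "bracket m z \<in> Z" if m: "m \<in> M" and z: "z \<in> Z" for m z
  proof -
    have "bracket d (bracket m z) \<in> C" if d: "d \<in> D" for d
    proof -
      have "bracket d (bracket m z) = bracket (bracket d m) z + bracket m (bracket d z)"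
        by (rule bracket_leibniz)
      moreover have "bracket (bracket d m) z \<in> C" "bracket m (bracket d z) \<in> C"
        using z d m MD MC unfolding Z_def by blast+
      ultimately show ?thesis
        using subspace_add[OF C] by simp
    qed
    then show ?thesis
      using z MA m unfolding Z_def by blast
  qed
  ultimately have "Z = C \<or> Z = A"
    by (rule irr)
  then show False
    using ker nontriv unfolding Z_def by blast
qed

section \<open>Maximal subalgebras and Engel subalgebras\<close>

text \<open>The kernels of the powers of \<open>ad x\<close> stabilise, say \<open>T\<close> is a power with \<open>engel x\<close> as
  kernel. Then \<open>T\<close> is injective on its range, hence bijective on \<open>M \<inter> range T\<close>. If \<open>y\<close>
  idealises \<open>M\<close>, then \<open>[x, y] \<in> M\<close> since \<open>x \<in> engel x\<close>, so \<open>T y\<close> lies in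
  \<open>M \<inter> range T\<close> and equals \<open>T z\<close> for some \<open>z \<in> M\<close>; thus \<open>y - z \<in> engel x\<close>.\<close>

lemma idealiser_of_engel_superset:
  assumes M: "subalgebra M" and E: "engel x \<subseteq> M"
  shows "idealiser M = M"
proof
  show "M \<subseteq> idealiser M"
    using M unfolding subalgebra_def idealiser_def by blast
next
  have Msub: "subspace M"
    using M unfolding subalgebra_def by blast
  have "x \<in> engel x"
    unfolding engel_def using bracket_self by (auto intro!: exI[of _ 1])
  then have xM: "x \<in> M"
    using E by blast
  then have Minv: "\<And>u. u \<in> M \<Longrightarrow> bracket x u \<in> M"
    using M unfolding subalgebra_def by blast
  define ker where "ker n = {y. (bracket x ^^ n) y = 0}" for n
  have ker_sub: "subspace (ker n)" for n
    using subspace_bracket_power_preimage[of "{0}" n x] subspace_single_0 by (simp add: ker_def)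
  have ker_mono: "ker j \<subseteq> ker k" if "j \<le> k" for j k
    unfolding ker_def using bracket_power_mem_mono[of "{0}" x j _ k] that by auto
  have "\<exists>n. True \<and> (\<forall>k. True \<longrightarrow> dim (ker k) \<le> dim (ker n))"
    using dim_subset_UNIV
    by (intro ex_has_greatest_nat[where k = 0 and b = "Suc dimension"]) (auto simp: less_Suc_eq_le)
  then obtain n where n: "\<And>k. dim (ker k) \<le> dim (ker n)"
    by blast
  have stable: "ker k \<subseteq> ker n" for k
  proof -
    have "ker n = ker (max n k)"
      by (rule subspace_dim_equal[OF ker_sub ker_sub ker_mono n]) simp
    then show ?thesis
      using ker_mono[of k "max n k"] by simp
  qed
  \<comment> \<open>The exponent must be positive: the last step needs \<open>T y \<in> M\<close> from \<open>[x, y] \<in> M\<close>.\<close>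
  define T where "T = (bracket x ^^ Suc n)"
  have T_lin: "Vector_Spaces.linear scale scale T"
    unfolding T_def by (rule linear_bracket_power)
  have T_ker: "y \<in> engel x" if "T y = 0" for y
    using that unfolding T_def engel_def by blast
  have T_sq: "T y = 0" if "T (T y) = 0" for y
  proof -
    have "y \<in> ker (Suc n + Suc n)"
      using that unfolding ker_def T_def funpow_add comp_apply by simp
    then have "y \<in> ker (Suc n)"
      using stable ker_mono[of n "Suc n"] by fastforce
    then show ?thesis
      unfolding ker_def T_def by blast
  qed
  have TM: "T u \<in> M" if "u \<in> M" for u
    unfolding T_def using bracket_power_mem[of M x u] Minv that by blast
  define P where "P = M \<inter> range T"
  have P_sub: "subspace P"
    unfolding P_def by (intro subspace_inter Msub endo.linear_subspace_image[OF T_lin] subspace_UNIV)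
  interpret pair: finite_dimensional_vector_space_pair_1 scale Basis scale ..
  have "inj_on T (span P)"
    unfolding span_eq_iff[THEN iffD2, OF P_sub]
  proof (rule inj_onI)
    fix u v assume uv: "u \<in> P" "v \<in> P" "T u = T v"
    then obtain w where w: "u - v = T w"
      using subspace_diff[OF P_sub, of u v] unfolding P_def by blast
    have "T (u - v) = 0"
      using endo.linear_diff[OF T_lin] uv(3) by simp
    then show "u = v"
      using w T_sq[of w] by simp
  qed
  then have "dim (T ` P) = dim P"
    by (rule pair.dim_image_eq[OF T_lin])
  then have TP: "T ` P = P"
    by (intro subspace_dim_equal endo.linear_subspace_image[OF T_lin] P_sub) (auto simp: P_def TM)
  show "idealiser M \<subseteq> M"
  proof
    fix y assume "y \<in> idealiser M"
    then have "bracket x y \<in> M"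
      using xM bracket_mem_swap[OF Msub] unfolding idealiser_def by blast
    then have "T y \<in> M"
      unfolding T_def funpow_Suc_right comp_apply
      using bracket_power_mem[of M x "bracket x y" n] Minv by blast
    then have "T y \<in> P"
      unfolding P_def by blast
    then obtain z where z: "z \<in> P" "T y = T z"
      using TP by blast
    then have "y - z \<in> M"
      using T_ker[of "y - z"] E endo.linear_diff[OF T_lin] by auto
    then show "y \<in> M"
      using subspace_add[OF Msub, of "y - z" z] z(1) unfolding P_def by simp
  qed
qed

text \<open>Only invariance under \<open>M\<close> has to be checked on \<open>A / C\<close>: since \<open>L = A + M\<close> and
  \<open>[A, A] \<subseteq> C\<close>, a subspace between \<open>C\<close> and \<open>A\<close> that is invariant under \<open>M\<close> is an
  ideal of \<open>L\<close>, to which the minimality of \<open>A\<close> applies.\<close>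

lemma engel_subset_of_idealiser_eq:
  assumes solv: solvable and M: "maximal_subalgebra M" and idl: "idealiser M = M"
  shows "\<exists>x. engel x \<subseteq> M"
proof -
  have Msub: "subspace M" and MM: "\<And>x y. x \<in> M \<Longrightarrow> y \<in> M \<Longrightarrow> bracket x y \<in> M"
    and "M \<noteq> UNIV" and Mmax: "\<And>U. subalgebra U \<Longrightarrow> M \<subseteq> U \<Longrightarrow> U = M \<or> U = UNIV"
    using M unfolding maximal_subalgebra_def subalgebra_def by blast+
  define P where "P I \<longleftrightarrow> lie_ideal I \<and> \<not> I \<subseteq> M" for I
  have "P UNIV"
    unfolding P_def lie_ideal_def using \<open>M \<noteq> UNIV\<close> by auto
  then obtain A where "P A" and Amin: "\<And>I. P I \<Longrightarrow> I \<subseteq> A \<Longrightarrow> I = A"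
    by (rule minimal_subspace_exists) (auto simp: P_def lie_ideal_def)
  then have Aid: "lie_ideal A" and AM: "\<not> A \<subseteq> M"
    unfolding P_def by blast+
  have Asub: "subspace A" and LA: "\<And>x a. a \<in> A \<Longrightarrow> bracket x a \<in> A"
    using Aid unfolding lie_ideal_def by blast+
  have AL: "bracket a x \<in> A" if "a \<in> A" for a x
    using bracket_mem_swap[OF Asub LA[OF that]] .
  define C where "C = A \<inter> M"
  have Csub: "subspace C"
    unfolding C_def by (intro subspace_inter Asub Msub)
  have dA: "derived A \<subseteq> A"
    by (rule derived_subset) (use Asub LA in auto)
  have "derived A \<subseteq> M"
  proof (rule ccontr)
    assume "\<not> derived A \<subseteq> M"
    then have "derived A = A"
      using Amin[of "derived A"] lie_ideal_derived[OF Aid] dA unfolding P_def by blast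
    then have "A \<subseteq> {0}"
      by (rule perfect_subset_zero[OF solv])
    then show False
      using AM subspace_0[OF Msub] by blast
  qed
  then have AA: "bracket a b \<in> C" if "a \<in> A" "b \<in> A" for a b
    using bracket_mem_derived[OF that] dA unfolding C_def by blast
  have MC: "bracket m c \<in> C" if "m \<in> M" "c \<in> C" for m c
    using that LA MM unfolding C_def by blast
  have decomp: "\<exists>a\<in>A. \<exists>m\<in>M. x = a + m" for x
  proof -
    define U where "U = {a + m |a m. a \<in> A \<and> m \<in> M}"
    have "subspace U"
      unfolding U_def by (rule subspace_sums[OF Asub Msub])
    moreover have "bracket u v \<in> U" if "u \<in> U" "v \<in> U" for u v
    proof -
      obtain a m b k where eq: "u = a + m" "v = b + k" "a \<in> A" "m \<in> M" "b \<in> A" "k \<in> M"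
        using \<open>u \<in> U\<close> \<open>v \<in> U\<close> unfolding U_def by blast
      have "bracket u v = (bracket a v + bracket m b) + bracket m k"
        unfolding eq bracket_add_left bracket_add_right by (simp only: ac_simps)
      moreover have "bracket a v + bracket m b \<in> A"
        using eq AL LA subspace_add[OF Asub] by blast
      ultimately show ?thesis
        unfolding U_def using MM eq by blast
    qed
    moreover have "M \<subseteq> U"
      unfolding U_def using subspace_0[OF Asub] by force
    moreover have "A \<subseteq> U"
      unfolding U_def using subspace_0[OF Msub] by force
    ultimately have "U = UNIV"
      using Mmax[of U] AM unfolding subalgebra_def by blast
    then show ?thesis
      unfolding U_def by blast
  qed
  have irr: "W = C \<or> W = A"
    if W: "subspace W" "C \<subseteq> W" "W \<subseteq> A" and inv: "\<And>m w. m \<in> M \<Longrightarrow> w \<in> W \<Longrightarrow> bracket m w \<in> W" for W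
  proof -
    have "bracket x w \<in> W" if "w \<in> W" for x w
    proof -
      obtain a m where "a \<in> A" "m \<in> M" "x = a + m"
        using decomp by blast
      then show ?thesis
        using AA[of a w] inv[of m w] W that by (auto simp: bracket_add_left intro!: subspace_add)
    qed
    then have "lie_ideal W"
      unfolding lie_ideal_def using W(1) by blast
    then show ?thesis
      using Amin[of W] W unfolding P_def C_def by blast
  qed
  define K where "K = {m\<in>M. \<forall>a\<in>A. bracket m a \<in> C}"
  have "\<not> M \<subseteq> K"
  proof
    assume "M \<subseteq> K"
    then have "A \<subseteq> idealiser M"
      using bracket_mem_swap[OF Msub] unfolding idealiser_def K_def C_def by blast
    then show False
      using AM idl by blast
  qed
  moreover have "0 \<in> K"
    unfolding K_def using subspace_0[OF Msub] subspace_0[OF Csub]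
    by (auto simp: endo.linear_0[OF linear_bracket_left])
  ultimately obtain i where i: "\<not> M \<inter> (derived ^^ i) UNIV \<subseteq> K" "M \<inter> (derived ^^ Suc i) UNIV \<subseteq> K"
    using solvable_last_derived[OF solv] by blast
  define D where "D = M \<inter> (derived ^^ i) UNIV"
  have LD: "subspace ((derived ^^ i) UNIV)" "\<And>x d. d \<in> (derived ^^ i) UNIV \<Longrightarrow> bracket x d \<in> (derived ^^ i) UNIV"
    using lie_ideal_derived_series[of i] unfolding lie_ideal_def by blast+
  have MD: "bracket d m \<in> D" if "m \<in> M" "d \<in> D" for m d
    using that MM bracket_mem_swap[OF LD(1) LD(2)] unfolding D_def by blast
  have comm: "bracket (bracket x y) a \<in> C" if "x \<in> D" "y \<in> D" "a \<in> A" for x y a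
  proof -
    have "bracket x y \<in> M \<inter> (derived ^^ Suc i) UNIV"
      using that MM bracket_mem_derived unfolding D_def by auto
    then show ?thesis
      using i(2) that unfolding K_def by blast
  qed
  obtain e b where eb: "e \<in> D" "b \<in> A" "bracket e b \<notin> C"
    using i(1) unfolding D_def K_def by blast
  have "\<exists>x\<in>D. \<forall>a\<in>A. \<forall>n. (bracket x ^^ n) a \<in> C \<longrightarrow> a \<in> C"
  proof (rule exists_acting_injectively[where M = M and e = e and b = b])
    show "C \<subseteq> A" "D \<subseteq> M"
      unfolding C_def D_def by blast+
    show "bracket m a \<in> A" if "m \<in> M" "a \<in> A" for m a
      using LA that by blast
  qed (fact Asub Csub MC irr MD comm eb)+
  then obtain x where x: "x \<in> D" and inj: "\<And>a n. a \<in> A \<Longrightarrow> (bracket x ^^ n) a \<in> C \<Longrightarrow> a \<in> C"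
    by blast
  have "engel x \<subseteq> M"
  proof
    fix y assume "y \<in> engel x"
    then obtain n where n: "(bracket x ^^ n) y = 0"
      unfolding engel_def by blast
    obtain a m where am: "a \<in> A" "m \<in> M" "y = a + m"
      using decomp by blast
    have "(bracket x ^^ n) a + (bracket x ^^ n) m = 0"
      using n unfolding am(3) endo.linear_add[OF linear_bracket_power] .
    then have "(bracket x ^^ n) a = - (bracket x ^^ n) m"
      by (rule eq_neg_iff_add_eq_0[THEN iffD2])
    moreover have "(bracket x ^^ n) m \<in> M"
      using bracket_power_mem[of M x m n] MM x am(2) unfolding D_def by blast
    moreover have "(bracket x ^^ n) a \<in> A"
      using bracket_power_mem[of A x a n] LA am(1) by blast
    ultimately have "a \<in> C"
      using inj[OF am(1), of n] subspace_neg[OF Msub] unfolding C_def by (metis IntI)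
    then show "y \<in> M"
      using am subspace_add[OF Msub] unfolding C_def by blast
  qed
  then show ?thesis
    by blast
qed

end

theorem corollary2p8:
  fixes scale :: "'f::field \<Rightarrow> 'a::ab_group_add \<Rightarrow> 'a"
    and bracket :: "'a \<Rightarrow> 'a \<Rightarrow> 'a"
    and Basis :: "'a set"
  assumes "lie_algebra scale bracket"
    and "finite_dimensional_vector_space scale Basis"
    and "lie_algebra.solvable scale bracket"
  shows "lie_algebra.gamma scale bracket = lie_algebra.tau scale bracket"
proof -
  interpret finite_dimensional_lie_algebra scale bracket Basis
    using assms(1,2) by (rule finite_dimensional_lie_algebra.intro)
  have "(\<exists>x. engel x \<subseteq> M) \<longleftrightarrow> idealiser M = M" if M: "maximal_subalgebra M" for M
  proof
    have "subalgebra M"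
      using M unfolding maximal_subalgebra_def by (rule conjunct1)
    then show "\<exists>x. engel x \<subseteq> M \<Longrightarrow> idealiser M = M"
      by (elim exE) (rule idealiser_of_engel_superset)
    show "idealiser M = M \<Longrightarrow> \<exists>x. engel x \<subseteq> M"
      by (rule engel_subset_of_idealiser_eq[OF assms(3) M])
  qed
  then have "G_max = T_max"
    unfolding G_max_def T_max_def by blast
  then show ?thesis
    unfolding gamma_def tau_def G_int_def T_int_def by simp
qed

end
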